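(* Let $\mathcal X$ and $\mathcal Y$ be infinite-dimensional separable real Hilbert spaces and let $T:\mathcal X\to\mathcal Y$ be an injective compact linear operator with singular values $\sigma_1\ge\sigma_2\ge\dots>0$. Let Definition II be applied to $T$ with the benchmark measure space $(\Omega,\mu)=(\mathbb N,\mu_{disc})$, where $\mu_{disc}$ is the counting measure, that is, with a spectral decomposition $W^*T^*TW=M_\lambda$ of $T^*T$ over $(\mathbb N,\mu_{disc})$. Then Definition II is applicable (i.e. conditions (a) and (b) in it hold), and the intervals of ill-posedness from Definitions I and II agree: $$A_\sigma=A_{\Phi_{\lambda,\mu_{disc}}},\qquad B_\sigma=B_{\Phi_{\lambda,\mu_{disc}}}.$$ In particular, for $s\in(0,\infty)$, the equation $Tu=g$ is ill-posed of degree $s$ in the sense of Definition I if and only if it is ill-posed of degree $s$ in the sense of Definition II.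
   Context: Spectral decomposition: for a bounded linear operator $T:\mathcal X\to\mathcal Y$, a spectral decomposition of $T^*T$ over a measure space $(\Omega,\mu)$ consists of a real-valued function $\lambda\in L^\infty(\Omega,\mu)$ and a unitary operator $W:L^2(\Omega,\mu)\to\mathcal X$ with $W^*T^*TW=M_\lambda$, where $[M_\lambda\xi](\omega)=\lambda(\omega)\xi(\omega)$ for $\mu$-a.e. $\omega$. Definition I (compact case): for $T$ injective and compact with singular values $\sigma_n$ (non-increasing, counted with multiplicity), $$[A_\sigma,B_\sigma]:=\left[\liminf_{n\to\infty}\frac{-\log(\sigma_n)}{\log(n)},\ \limsup_{n\to\infty}\frac{-\log(\sigma_n)}{\log(n)}\right]\subset[0,\infty]$$ is the interval of ill-posedness of $Tu=g$, and the equation is ill-posed of degree $s\in(0,\infty)$ if $A_\sigma=B_\sigma=s$. Definition II (general case): let $T$ be injective and bounded with non-closed range, with a spectral decomposition $W^*T^*TW=M_\lambda$ over $(\Omega,\mu)$. Put $\Phi_{\lambda,\mu}(\epsilon):=\mu(\{\omega\in\Omega:\lambda(\omega)>\epsilon\})$ for $\epsilon>0$, and assume (a) $\mu(\Omega)=\infty$; (b) $0\le\Phi_{\lambda,\mu}(\epsilon)<\infty$ for all $\epsilon>0$ and $\lim_{\epsilon\searrow0}\Phi_{\lambda,\mu}(\epsilon)=\infty$. Then $$[A_{\Phi_{\lambda,\mu}},B_{\Phi_{\lambda,\mu}}]:=\left[\liminf_{\epsilon\searrow0}\frac{\log(\epsilon)}{-2\log(\Phi_{\lambda,\mu}(\epsilon))},\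 \limsup_{\epsilon\searrow0}\frac{\log(\epsilon)}{-2\log(\Phi_{\lambda,\mu}(\epsilon))}\right]\subset[0,\infty]$$ is the interval of ill-posedness of $Tu=g$, and the equation is ill-posed of degree $s\in(0,\infty)$ if $A_{\Phi_{\lambda,\mu}}=B_{\Phi_{\lambda,\mu}}=s$. *)

theory Defs
  imports "HOL-Analysis.Analysis"
begin

text \<open>
  Real Hilbert spaces are types of sort \<open>{real_inner, complete_space}\<close>.
\<close>

definition infinite_dimensional :: "'a::real_vector itself \<Rightarrow> bool" where
  "infinite_dimensional _ \<longleftrightarrow> \<not> (\<exists>B::'a set. finite B \<and> span B = UNIV)"

definition compact_operator :: "('a::real_normed_vector \<Rightarrow> 'b::real_normed_vector) \<Rightarrow> bool" where
  "compact_operator T \<longleftrightarrow> linear T \<and> (\<forall>S. bounded S \<longrightarrow> compact (closure (T ` S)))"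


subsection \<open>Singular values and the interval of ill-posedness in the compact case\<close>

text \<open>
  \<open>is_singular_values T \<sigma>\<close>: the positive numbers \<open>\<sigma> 1 \<ge> \<sigma> 2 \<ge> \<dots>\<close> are the singular values of \<open>T\<close>,
  i.e. the square roots of the positive eigenvalues of \<open>T\<^sup>* T\<close>; each occurs as often as the dimension
  of the eigenspace. The sequence is indexed from 1 and \<open>\<sigma> 0\<close> is irrelevant. The finiteness clause
  is needed because both \<open>card\<close> and \<open>dim\<close> are 0 in the infinite case.
\<close>

definition is_singular_values ::
    "('a::real_inner \<Rightarrow> 'b::real_inner) \<Rightarrow> (nat \<Rightarrow> real) \<Rightarrow> bool" where
  "is_singular_values T \<sigma> \<longleftrightarrow>
     (\<forall>n\<ge>1. \<sigma> n > 0) \<and>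
     (\<forall>m n. 1 \<le> m \<and> m \<le> n \<longrightarrow> \<sigma> n \<le> \<sigma> m) \<and>
     (\<forall>t>0. finite {n. 1 \<le> n \<and> \<sigma> n = t} \<and>
            card {n. 1 \<le> n \<and> \<sigma> n = t} = dim {x. adjoint T (T x) = t\<^sup>2 *\<^sub>R x})"

definition A_sv :: "(nat \<Rightarrow> real) \<Rightarrow> ereal" where
  "A_sv \<sigma> = liminf (\<lambda>n. ereal (- ln (\<sigma> n) / ln (real n)))"

definition B_sv :: "(nat \<Rightarrow> real) \<Rightarrow> ereal" where
  "B_sv \<sigma> = limsup (\<lambda>n. ereal (- ln (\<sigma> n) / ln (real n)))"

definition ill_posed_of_degree_I ::
    "('a::real_inner \<Rightarrow> 'b::real_inner) \<Rightarrow> (nat \<Rightarrow> real) \<Rightarrow> real \<Rightarrow> bool" where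
  "ill_posed_of_degree_I T \<sigma> s \<longleftrightarrow>
     inj T \<and> compact_operator T \<and> is_singular_values T \<sigma> \<and>
     0 < s \<and> A_sv \<sigma> = ereal s \<and> B_sv \<sigma> = ereal s"


subsection \<open>Spectral decompositions\<close>

text \<open>
  The elements of \<open>L\<^sup>2(\<Omega>,\<mu>)\<close> are represented by square-integrable functions, identified
  almost everywhere; an operator on \<open>L\<^sup>2(\<Omega>,\<mu>)\<close> is a function on representatives that respects
  this identification.
\<close>

definition L2 :: "'w measure \<Rightarrow> ('w \<Rightarrow> real) set" where
  "L2 M = {f \<in> borel_measurable M. integrable M (\<lambda>\<omega>. (f \<omega>)\<^sup>2)}"

definition Linf :: "'w measure \<Rightarrow> ('w \<Rightarrow> real) set" where
  "Linf M = {f \<in> borel_measurable M. \<exists>C. AE \<omega> in M. \<bar>f \<omega>\<bar> \<le> C}"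

definition unitary_on_L2 :: "'w measure \<Rightarrow> (('w \<Rightarrow> real) \<Rightarrow> 'a::real_inner) \<Rightarrow> bool" where
  "unitary_on_L2 M W \<longleftrightarrow>
     (\<forall>f\<in>L2 M. \<forall>g\<in>L2 M. (AE \<omega> in M. f \<omega> = g \<omega>) \<longrightarrow> W f = W g) \<and>
     (\<forall>f\<in>L2 M. \<forall>g\<in>L2 M. W (\<lambda>\<omega>. f \<omega> + g \<omega>) = W f + W g) \<and>
     (\<forall>c. \<forall>f\<in>L2 M. W (\<lambda>\<omega>. c * f \<omega>) = c *\<^sub>R W f) \<and>
     (\<forall>f\<in>L2 M. \<forall>g\<in>L2 M. inner (W f) (W g) = (\<integral>\<omega>. f \<omega> * g \<omega> \<partial>M)) \<and>
     W ` L2 M = UNIV"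

text \<open>
  A representative of \<open>W\<^sup>* x\<close>, determined up to equality almost everywhere; compare \<^const>\<open>adjoint\<close>.
\<close>

definition L2_adjoint ::
    "'w measure \<Rightarrow> (('w \<Rightarrow> real) \<Rightarrow> 'a::real_inner) \<Rightarrow> 'a \<Rightarrow> ('w \<Rightarrow> real)" where
  "L2_adjoint M W x =
     (SOME h. h \<in> L2 M \<and> (\<forall>f\<in>L2 M. inner (W f) x = (\<integral>\<omega>. f \<omega> * h \<omega> \<partial>M)))"

definition spectral_decomposition ::
    "('a::real_inner \<Rightarrow> 'b::real_inner) \<Rightarrow> 'w measure \<Rightarrow> (('w \<Rightarrow> real) \<Rightarrow> 'a) \<Rightarrow> ('w \<Rightarrow> real) \<Rightarrow> bool"
  where
  "spectral_decomposition T M W lam \<longleftrightarrow>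
     lam \<in> Linf M \<and> unitary_on_L2 M W \<and>
     (\<forall>\<xi>\<in>L2 M. AE \<omega> in M. L2_adjoint M W (adjoint T (T (W \<xi>))) \<omega> = lam \<omega> * \<xi> \<omega>)"


subsection \<open>The interval of ill-posedness in the general case\<close>

definition Phi :: "('w \<Rightarrow> real) \<Rightarrow> 'w measure \<Rightarrow> real \<Rightarrow> ennreal" where
  "Phi lam M \<epsilon> = emeasure M {\<omega> \<in> space M. lam \<omega> > \<epsilon>}"

definition condition_a :: "'w measure \<Rightarrow> bool" where
  "condition_a M \<longleftrightarrow> emeasure M (space M) = \<infinity>"

definition condition_b :: "('w \<Rightarrow> real) \<Rightarrow> 'w measure \<Rightarrow> bool" where
  "condition_b lam M \<longleftrightarrow>
     (\<forall>\<epsilon>>0. Phi lam M \<epsilon> < \<infinity>) \<and> (Phi lam M \<longlongrightarrow> \<infinity>) (at_right 0)"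

definition definition_II_applicable ::
    "('a::real_inner \<Rightarrow> 'b::real_inner) \<Rightarrow> 'w measure \<Rightarrow> (('w \<Rightarrow> real) \<Rightarrow> 'a) \<Rightarrow> ('w \<Rightarrow> real) \<Rightarrow> bool"
  where
  "definition_II_applicable T M W lam \<longleftrightarrow>
     inj T \<and> bounded_linear T \<and> \<not> closed (range T) \<and>
     spectral_decomposition T M W lam \<and> condition_a M \<and> condition_b lam M"

text \<open>
  Under \<^const>\<open>condition_b\<close>, \<^const>\<open>Phi\<close> is finite, so that \<open>enn2real\<close> loses nothing, and exceeds 1 for
  all small \<open>\<epsilon>\<close>, so that the quotient is a genuine one near the limit.
\<close>

definition A_Phi :: "('w \<Rightarrow> real) \<Rightarrow> 'w measure \<Rightarrow> ereal" where
  "A_Phi lam M = Liminf (at_right 0) (\<lambda>\<epsilon>. ereal (ln \<epsilon> / (- 2 * ln (enn2real (Phi lam M \<epsilon>)))))"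

definition B_Phi :: "('w \<Rightarrow> real) \<Rightarrow> 'w measure \<Rightarrow> ereal" where
  "B_Phi lam M = Limsup (at_right 0) (\<lambda>\<epsilon>. ereal (ln \<epsilon> / (- 2 * ln (enn2real (Phi lam M \<epsilon>)))))"

definition ill_posed_of_degree_II ::
    "('a::real_inner \<Rightarrow> 'b::real_inner) \<Rightarrow> 'w measure \<Rightarrow> (('w \<Rightarrow> real) \<Rightarrow> 'a) \<Rightarrow> ('w \<Rightarrow> real) \<Rightarrow> real \<Rightarrow> bool"
  where
  "ill_posed_of_degree_II T M W lam s \<longleftrightarrow>
     definition_II_applicable T M W lam \<and>
     0 < s \<and> A_Phi lam M = ereal s \<and> B_Phi lam M = ereal s"

end

theory Submission
  imports Defs
begin

text \<open>
  The images \<open>e n = W (indicator {n})\<close> form an orthonormal basis of eigenvectors of \<open>T\<^sup>* T\<close> with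
  eigenvalues \<open>lam n = (norm (T (e n)))\<^sup>2\<close>. As the \<open>T (e n)\<close> are orthogonal, compactness forces
  \<open>lam\<close> to tend to 0, and each eigenspace is spanned by the basis vectors it contains. Hence \<open>lam\<close>
  and the squared singular values have the same counting function \<open>N \<epsilon>\<close>, which equals
  \<open>Phi lam (count_space UNIV) \<epsilon>\<close> and satisfies \<open>n \<le> N \<epsilon> \<longleftrightarrow> \<epsilon> < (\<sigma> n)\<^sup>2\<close>. This Galois connection bounds
  \<open>ln \<epsilon> / (- 2 * ln (N \<epsilon>))\<close> between \<open>- ln (\<sigma> (N \<epsilon>)) / ln (N \<epsilon>)\<close> and
  \<open>- ln (\<sigma> (N \<epsilon> + 1)) / ln (N \<epsilon>)\<close>; the remaining two inequalities come from the test sequences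
  \<open>\<epsilon> = (\<sigma> n)\<^sup>2 / 4\<close> for the lower and \<open>\<epsilon> = (\<sigma> n)\<^sup>2\<close> for the upper limit.
\<close>

subsection \<open>Counting functions and growth exponents\<close>

text \<open>The upper bound in \<open>quotient_bounds\<close> pairs the singular value at n + 1 with
  ln n. This limit, from ln (n + 1) = ln n + ln (1 + 1 / n), lets ln (n + 1) take the place of ln
  n.\<close>

lemma tendsto_ln_Suc_over_ln:
  "(\<lambda>n. ln (real (Suc n)) / ln (real n)) \<longlonglongrightarrow> 1"
proof -
  have "(\<lambda>n. 1 + ln (1 + 1 / real n) / ln (real n)) \<longlonglongrightarrow> 1 + 0"
  proof (intro tendsto_add tendsto_const)
    have "(\<lambda>n. ln (1 + 1 / real n)) \<longlonglongrightarrow> ln (1 + 0)"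
      by (intro tendsto_intros lim_1_over_n) auto
    then show "(\<lambda>n. ln (1 + 1 / real n) / ln (real n)) \<longlonglongrightarrow> 0"
      by (intro real_tendsto_divide_at_top[where c = 0]
          filterlim_compose[OF ln_at_top filterlim_real_sequentially]) simp_all
  qed
  moreover have "eventually (\<lambda>n. 1 + ln (1 + 1 / real n) / ln (real n)
      = ln (real (Suc n)) / ln (real n)) sequentially"
    using eventually_ge_at_top[of 2]
  proof eventually_elim
    case (elim n)
    have "1 + 1 / real n = real (Suc n) / real n"
      using elim by (simp add: field_simps)
    then have "ln (1 + 1 / real n) = ln (real (Suc n)) - ln (real n)"
      using elim by (simp add: ln_div)
    moreover have "ln (real n) > 0"
      using elim by simp
    ultimately show ?case
      by (simp add: field_simps)
  qed
  ultimately show ?thesis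
    using Lim_transform_eventually by fastforce
qed

text \<open>A substitution sees only part of the approach to the limit, so it can only raise a lower
  limit. It serves for both passages: from n to \<epsilon> through \<open>N\<close>, and back
  through a test sequence.\<close>

lemma Liminf_filterlim_le:
  fixes f :: "'b \<Rightarrow> 'c::complete_linorder"
  assumes "filterlim g G F"
  shows "Liminf G f \<le> Liminf F (\<lambda>x. f (g x))"
  unfolding le_Liminf_iff
  using less_LiminfD filterlim_iff[THEN iffD1, OF assms] by blast

lemma Limsup_filterlim_le:
  fixes f :: "'b \<Rightarrow> 'c::complete_linorder"
  assumes "filterlim g G F"
  shows "Limsup F (\<lambda>x. f (g x)) \<le> Limsup G f"
  unfolding Limsup_le_iff
  using Limsup_lessD filterlim_iff[THEN iffD1, OF assms] by blast

text \<open>The growth exponents depend only on this Galois connection. It makes \<sigma>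
  non-increasing from index 1 on and forces it to tend to 0.\<close>

context
  fixes \<sigma> :: "nat \<Rightarrow> real" and N :: "real \<Rightarrow> nat"
  assumes pos: "\<And>n. 1 \<le> n \<Longrightarrow> 0 < \<sigma> n"
    and le_N_iff: "\<And>\<epsilon> n. 0 < \<epsilon> \<Longrightarrow> 1 \<le> n \<Longrightarrow> n \<le> N \<epsilon> \<longleftrightarrow> \<epsilon> < (\<sigma> n)\<^sup>2"
begin

lemma counting_function_at_top: "filterlim N at_top (at_right 0)"
  unfolding filterlim_at_top
proof
  fix m
  have "eventually (\<lambda>\<epsilon>. \<epsilon> \<in> {0<..<(\<sigma> (Suc m))\<^sup>2}) (at_right 0)"
    using pos[of "Suc m"] by (intro eventually_at_right_real) auto
  then show "eventually (\<lambda>\<epsilon>. m \<le> N \<epsilon>) (at_right 0)"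
    by eventually_elim (use le_N_iff[of _ "Suc m"] in force)
qed

lemma square_at_right_0:
  assumes "0 < c"
  shows "filterlim (\<lambda>n. c * (\<sigma> n)\<^sup>2) (at_right 0) sequentially"
proof -
  have pos_ev: "eventually (\<lambda>n. 0 < (\<sigma> n)\<^sup>2) sequentially"
    using eventually_ge_at_top[of 1] by eventually_elim (use pos in force)
  have "(\<lambda>n. (\<sigma> n)\<^sup>2) \<longlonglongrightarrow> 0"
  proof (rule order_tendstoI)
    fix a :: real assume "a < 0"
    then show "eventually (\<lambda>n. a < (\<sigma> n)\<^sup>2) sequentially"
      by (intro always_eventually allI) (meson less_le_trans zero_le_power2)
  next
    fix a :: real assume "0 < a"
    \<comment> \<open>Beyond \<open>N (a / 2)\<close> the Galois connection gives only a non-strict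
      bound; halving \<open>a\<close> makes it strict.\<close>
    then have "(\<sigma> n)\<^sup>2 < a" if "n \<ge> Suc (N (a / 2))" for n
      using that le_N_iff[of "a / 2" n] by fastforce
    then show "eventually (\<lambda>n. (\<sigma> n)\<^sup>2 < a) sequentially"
      unfolding eventually_sequentially by blast
  qed
  then have "(\<lambda>n. c * (\<sigma> n)\<^sup>2) \<longlonglongrightarrow> 0"
    by (rule tendsto_mult_right_zero)
  moreover have "eventually (\<lambda>n. c * (\<sigma> n)\<^sup>2 \<in> {0<..}) sequentially"
    using pos_ev by eventually_elim (simp add: assms)
  ultimately show ?thesis
    using pos_ev by (auto simp: filterlim_at elim: eventually_mono)
qed

lemma eventually_small_and_many:
  "eventually (\<lambda>\<epsilon>. 0 < \<epsilon> \<and> \<epsilon> < 1 \<and> k \<le> N \<epsilon>) (at_right 0)"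
proof -
  have "eventually (\<lambda>\<epsilon>::real. \<epsilon> \<in> {0<..<1}) (at_right 0)"
    by (intro eventually_at_right_real) auto
  moreover have "eventually (\<lambda>\<epsilon>. k \<le> N \<epsilon>) (at_right 0)"
    using counting_function_at_top by (auto simp: filterlim_at_top)
  ultimately show ?thesis
    by eventually_elim auto
qed

lemma ln_square: "1 \<le> n \<Longrightarrow> ln ((\<sigma> n)\<^sup>2) = 2 * ln (\<sigma> n)"
  using pos[of n] by (simp add: ln_realpow)

text \<open>\<open>N \<epsilon>\<close> is the last index whose squared singular value exceeds
  \<epsilon>, and \<open>N \<epsilon> + 1\<close> the first where it does not. Logarithms trap ln
  \<epsilon> between the two, and \<open>2 \<le> N \<epsilon>\<close> makes the denominator
  positive.\<close>

lemma quotient_bounds: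
  assumes "0 < \<epsilon>" "\<epsilon> < 1" "2 \<le> N \<epsilon>"
  shows "- ln (\<sigma> (N \<epsilon>)) / ln (real (N \<epsilon>)) \<le> ln \<epsilon> / (- 2 * ln (real (N \<epsilon>)))"
    and "ln \<epsilon> / (- 2 * ln (real (N \<epsilon>))) \<le> - ln (\<sigma> (Suc (N \<epsilon>))) / ln (real (N \<epsilon>))"
proof -
  have L: "ln (real (N \<epsilon>)) > 0"
    using assms by simp
  have "\<epsilon> < (\<sigma> (N \<epsilon>))\<^sup>2"
    using assms le_N_iff[of \<epsilon> "N \<epsilon>"] by simp
  then have "ln \<epsilon> \<le> ln ((\<sigma> (N \<epsilon>))\<^sup>2)"
    using assms by (intro ln_mono) auto
  then have "ln \<epsilon> \<le> 2 * ln (\<sigma> (N \<epsilon>))"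
    using assms ln_square by simp
  then show "- ln (\<sigma> (N \<epsilon>)) / ln (real (N \<epsilon>)) \<le> ln \<epsilon> / (- 2 * ln (real (N \<epsilon>)))"
    using L by (simp add: field_simps)
  have "(\<sigma> (Suc (N \<epsilon>)))\<^sup>2 \<le> \<epsilon>"
    using assms le_N_iff[of \<epsilon> "Suc (N \<epsilon>)"] by simp
  then have "ln ((\<sigma> (Suc (N \<epsilon>)))\<^sup>2) \<le> ln \<epsilon>"
    using assms pos[of "Suc (N \<epsilon>)"] by simp
  then have "2 * ln (\<sigma> (Suc (N \<epsilon>))) \<le> ln \<epsilon>"
    using ln_square[of "Suc (N \<epsilon>)"] by simp
  then show "ln \<epsilon> / (- 2 * ln (real (N \<epsilon>))) \<le> - ln (\<sigma> (Suc (N \<epsilon>))) / ln (real (N \<epsilon>))"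
    using L by (simp add: field_simps)
qed

lemma liminf_eq_Liminf_counting_function:
  "liminf (\<lambda>n. ereal (- ln (\<sigma> n) / ln (real n)))
    = Liminf (at_right 0) (\<lambda>\<epsilon>. ereal (ln \<epsilon> / (- 2 * ln (real (N \<epsilon>)))))"
    (is "liminf ?a = Liminf _ ?g")
proof (rule antisym)
  have "liminf ?a \<le> Liminf (at_right 0) (\<lambda>\<epsilon>. ?a (N \<epsilon>))"
    using counting_function_at_top by (rule Liminf_filterlim_le)
  also have "\<dots> \<le> Liminf (at_right 0) ?g"
    using eventually_small_and_many[of 2]
    by (intro Liminf_mono, eventually_elim) (use quotient_bounds(1) in simp)
  finally show "liminf ?a \<le> Liminf (at_right 0) ?g" .
next
  text \<open>The factor \<open>1 / 4\<close> secures \<open>n \<le> N (\<delta> n)\<close> although singular values may be repeated.\<close>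
  define \<delta> where "\<delta> n = (1 / 4) * (\<sigma> n)\<^sup>2" for n
  have \<delta>: "filterlim \<delta> (at_right 0) sequentially"
    unfolding \<delta>_def by (rule square_at_right_0) simp
  have bound: "?g (\<delta> n) \<le> ereal (ln 2 / ln (real n)) + ?a n"
    if n: "2 \<le> n" and \<delta>1: "\<delta> n < 1" for n
  proof -
    have "\<delta> n > 0" "\<delta> n < (\<sigma> n)\<^sup>2"
      using pos[of n] n by (auto simp: \<delta>_def)
    then have "n \<le> N (\<delta> n)"
      using le_N_iff[of "\<delta> n" n] n by simp
    then have L: "0 < ln (real n)" "ln (real n) \<le> ln (real (N (\<delta> n)))"
      using n by auto
    have "\<delta> n = (\<sigma> n / 2)\<^sup>2"
      by (simp add: \<delta>_def power2_eq_square)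
    then have ln_\<delta>: "ln (\<delta> n) = 2 * (ln (\<sigma> n) - ln 2)"
      using pos[of n] n by (simp add: ln_realpow ln_div)
    have "ln (\<delta> n) / (- 2 * ln (real (N (\<delta> n)))) = - ln (\<delta> n) / (2 * ln (real (N (\<delta> n))))"
      by simp
    \<comment> \<open>As \<open>\<delta> n < 1\<close>, the numerator is positive, so passing from
      \<open>N (\<delta> n)\<close> down to n enlarges the quotient.\<close>
    also have "\<dots> \<le> - ln (\<delta> n) / (2 * ln (real n))"
      using \<open>\<delta> n > 0\<close> \<delta>1 L by (intro divide_left_mono mult_pos_pos) auto
    also have "\<dots> = ln 2 / ln (real n) + - ln (\<sigma> n) / ln (real n)"
      using L by (simp add: ln_\<delta> field_simps)
    finally show ?thesis
      unfolding plus_ereal.simps ereal_less_eq .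
  qed
  have "Liminf (at_right 0) ?g \<le> liminf (\<lambda>n. ?g (\<delta> n))"
    using \<delta> by (rule Liminf_filterlim_le)
  also have "\<dots> \<le> liminf (\<lambda>n. ereal (ln 2 / ln (real n)) + ?a n)"
  proof (rule Liminf_mono)
    have "eventually (\<lambda>n. \<delta> n < 1) sequentially"
      using eventually_compose_filterlim[OF eventually_small_and_many[of 2] \<delta>]
      by eventually_elim simp
    with eventually_ge_at_top[of 2]
    show "eventually (\<lambda>n. ?g (\<delta> n) \<le> ereal (ln 2 / ln (real n)) + ?a n) sequentially"
      by eventually_elim (rule bound)
  qed
  \<comment> \<open>The price of the factor 1 / 4 is the summand ln 2 / ln n, which vanishes in the
    limit.\<close>
  also have "\<dots> = 0 + liminf ?a"
  proof (rule ereal_liminf_lim_add)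
    have "(\<lambda>n. ln 2 / ln (real n)) \<longlonglongrightarrow> 0"
      by (intro real_tendsto_divide_at_top[OF tendsto_const]
          filterlim_compose[OF ln_at_top filterlim_real_sequentially])
    then show "(\<lambda>n. ereal (ln 2 / ln (real n))) \<longlonglongrightarrow> 0"
      by (simp add: zero_ereal_def)
  qed simp
  finally show "Liminf (at_right 0) ?g \<le> liminf ?a"
    by simp
qed

lemma limsup_eq_Limsup_counting_function:
  "limsup (\<lambda>n. ereal (- ln (\<sigma> n) / ln (real n)))
    = Limsup (at_right 0) (\<lambda>\<epsilon>. ereal (ln \<epsilon> / (- 2 * ln (real (N \<epsilon>)))))"
    (is "limsup ?a = Limsup _ ?g")
proof (rule antisym)
  \<comment> \<open>At this \<epsilon> the strict inequality of the Galois connection fails for n,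
    so \<open>N \<epsilon> < n\<close>, the direction an upper limit wants. The factor 1 fits the
    shape of \<open>square_at_right_0\<close>.\<close>
  define \<delta> where "\<delta> n = 1 * (\<sigma> n)\<^sup>2" for n
  have \<delta>: "filterlim \<delta> (at_right 0) sequentially"
    unfolding \<delta>_def by (rule square_at_right_0) simp
  have bound: "?a n \<le> ?g (\<delta> n)"
    if n: "2 \<le> n" and \<delta>1: "\<delta> n < 1" "2 \<le> N (\<delta> n)" for n
  proof -
    have "\<delta> n > 0"
      using pos[of n] n by (auto simp: \<delta>_def)
    then have "N (\<delta> n) \<le> n"
      using le_N_iff[of "\<delta> n" n] n by (simp add: \<delta>_def)
    then have L: "0 < ln (real (N (\<delta> n)))" "ln (real (N (\<delta> n))) \<le> ln (real n)" "0 < ln (real n)"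
      using \<delta>1 n by auto
    have "- ln (\<sigma> n) / ln (real n) = - ln (\<delta> n) / (2 * ln (real n))"
      using ln_square[of n] n by (simp add: \<delta>_def)
    also have "\<dots> \<le> - ln (\<delta> n) / (2 * ln (real (N (\<delta> n))))"
      using \<open>\<delta> n > 0\<close> \<delta>1 L by (intro divide_left_mono mult_pos_pos) auto
    finally show ?thesis
      by simp
  qed
  have "limsup ?a \<le> limsup (\<lambda>n. ?g (\<delta> n))"
  proof (rule Limsup_mono)
    have "eventually (\<lambda>n. \<delta> n < 1 \<and> 2 \<le> N (\<delta> n)) sequentially"
      using eventually_compose_filterlim[OF eventually_small_and_many[of 2] \<delta>]
      by eventually_elim simp
    with eventually_ge_at_top[of 2]
    show "eventually (\<lambda>n. ?a n \<le> ?g (\<delta> n)) sequentially"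
      by eventually_elim (use bound in blast)
  qed
  also have "\<dots> \<le> Limsup (at_right 0) ?g"
    using \<delta> by (rule Limsup_filterlim_le)
  finally show "limsup ?a \<le> Limsup (at_right 0) ?g" .
next
  \<comment> \<open>In \<open>r n * ?a (Suc n)\<close> the logarithm of n + 1 cancels, which leaves
    the upper bound of \<open>quotient_bounds\<close>; and \<open>r\<close> tends to 1.\<close>
  define r where "r n = ereal (ln (real (Suc n)) / ln (real n))" for n
  have "Limsup (at_right 0) ?g \<le> Limsup (at_right 0) (\<lambda>\<epsilon>. r (N \<epsilon>) * ?a (Suc (N \<epsilon>)))"
    using eventually_small_and_many[of 2]
    by (intro Limsup_mono, eventually_elim) (use quotient_bounds(2) in \<open>simp add: r_def\<close>)
  also have "\<dots> \<le> limsup (\<lambda>n. r n * ?a (Suc n))"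
    using counting_function_at_top by (rule Limsup_filterlim_le)
  also have "\<dots> = 1 * limsup (\<lambda>n. ?a (Suc n))"
  proof (rule ereal_limsup_lim_mult)
    show "r \<longlonglongrightarrow> 1"
      unfolding r_def one_ereal_def lim_ereal by (rule tendsto_ln_Suc_over_ln)
  qed auto
  also have "\<dots> \<le> limsup ?a"
    unfolding mult_1 using filterlim_Suc by (rule Limsup_filterlim_le)
  finally show "Limsup (at_right 0) ?g \<le> limsup ?a" .
qed

end

section \<open>Cardinalities of superlevel sets\<close>

text \<open>A finite superlevel set of a non-increasing sequence is an initial segment
  \<open>{1..k}\<close>, where k is its cardinality.\<close>

lemma le_card_superlevel_iff:
  fixes f :: "nat \<Rightarrow> 'a::linorder"
  assumes dec: "\<And>m n. 1 \<le> m \<Longrightarrow> m \<le> n \<Longrightarrow> f n \<le> f m"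
    and fin: "finite {n. 1 \<le> n \<and> \<epsilon> < f n}" and n: "1 \<le> n"
  shows "n \<le> card {n. 1 \<le> n \<and> \<epsilon> < f n} \<longleftrightarrow> \<epsilon> < f n"
proof
  assume "\<epsilon> < f n"
  then have "{1..n} \<subseteq> {n. 1 \<le> n \<and> \<epsilon> < f n}"
    using dec[of _ n] by (auto intro: less_le_trans)
  then show "n \<le> card {n. 1 \<le> n \<and> \<epsilon> < f n}"
    using card_mono[OF fin, of "{1..n}"] by simp
next
  assume le: "n \<le> card {n. 1 \<le> n \<and> \<epsilon> < f n}"
  show "\<epsilon> < f n"
  proof (rule ccontr)
    assume "\<not> \<epsilon> < f n"
    then have "m < n" if "\<epsilon> < f m" for m
      using dec[OF n, of m] that by (meson less_le_trans not_le)
    then have "{n. 1 \<le> n \<and> \<epsilon> < f n} \<subseteq> {1..<n}"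
      by auto
    then have "card {n. 1 \<le> n \<and> \<epsilon> < f n} \<le> n - 1"
      using card_mono[of "{1..<n}"] by simp
    with le n show False
      by linarith
  qed
qed

text \<open>Both superlevel sets split into fibres over the values above \<epsilon>, of which only
  finitely many occur, and the fibres have equal size.\<close>

lemma card_superlevel_eq:
  fixes f :: "'a \<Rightarrow> 'c::linorder" and g :: "'b \<Rightarrow> 'c"
  assumes fin: "finite {x \<in> A. \<epsilon> < f x}"
    and fib_fin: "\<And>c. \<epsilon> < c \<Longrightarrow> finite {y \<in> B. g y = c}"
    and fib: "\<And>c. \<epsilon> < c \<Longrightarrow> card {y \<in> B. g y = c} = card {x \<in> A. f x = c}"
  shows "finite {y \<in> B. \<epsilon> < g y}" "card {y \<in> B. \<epsilon> < g y} = card {x \<in> A. \<epsilon> < f x}"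
proof -
  let ?C = "f ` {x \<in> A. \<epsilon> < f x}"
  have fibA_fin: "finite {x \<in> A. f x = c}" if "\<epsilon> < c" for c
    using fin by (rule rev_finite_subset) (use that in auto)
  \<comment> \<open>A finite nonempty fibre of \<open>g\<close> has nonzero cardinality, so
    \<open>f\<close> attains the same value.\<close>
  have "g y \<in> ?C" if "y \<in> B" "\<epsilon> < g y" for y
  proof -
    have "card {y' \<in> B. g y' = g y} \<noteq> 0"
      using fib_fin[OF that(2)] that(1) by auto
    then have "{x \<in> A. f x = g y} \<noteq> {}"
      using fib[OF that(2)] by (metis card.empty)
    then show ?thesis
      using that(2) by (auto simp: image_iff)
  qed
  then have B: "{y \<in> B. \<epsilon> < g y} = (\<Union>c\<in>?C. {y \<in> B. g y = c})"
    by auto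
  have A: "{x \<in> A. \<epsilon> < f x} = (\<Union>c\<in>?C. {x \<in> A. f x = c})"
    by auto
  show "finite {y \<in> B. \<epsilon> < g y}"
    unfolding B using fin fib_fin by auto
  have "card {y \<in> B. \<epsilon> < g y} = (\<Sum>c\<in>?C. card {y \<in> B. g y = c})"
    unfolding B using fin fib_fin by (intro card_UN_disjoint) auto
  also have "\<dots> = (\<Sum>c\<in>?C. card {x \<in> A. f x = c})"
    using fib by (intro sum.cong) auto
  also have "\<dots> = card (\<Union>c\<in>?C. {x \<in> A. f x = c})"
    using fin fibA_fin by (intro card_UN_disjoint[symmetric]) auto
  finally show "card {y \<in> B. \<epsilon> < g y} = card {x \<in> A. \<epsilon> < f x}"
    unfolding A[symmetric] .
qed


subsection \<open>Compact operators diagonalised by an orthonormal basis\<close>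

text \<open>
  The sort \<open>{real_normed_vector, complete_space}\<close> is not recognised as \<^class>\<open>banach\<close>, so
  \<open>summable_norm_cancel\<close> does not apply.
\<close>

lemma summable_norm_cancel_complete:
  fixes f :: "nat \<Rightarrow> 'b::{real_normed_vector, complete_space}"
  assumes "summable (\<lambda>n. norm (f n))"
  shows "summable f"
proof -
  have "Cauchy (\<lambda>n. \<Sum>k<n. f k)"
  proof (rule metric_CauchyI)
    fix \<epsilon> :: real assume "0 < \<epsilon>"
    then obtain M where M: "\<And>m n. M \<le> m \<Longrightarrow> norm (\<Sum>k=m..<n. norm (f k)) < \<epsilon>"
      using assms unfolding summable_Cauchy by blast
    have close: "dist (\<Sum>k<m. f k) (\<Sum>k<n. f k) < \<epsilon>" if "M \<le> m" "m \<le> n" for m n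
    proof -
      have "dist (\<Sum>k<m. f k) (\<Sum>k<n. f k) = norm (\<Sum>k=m..<n. f k)"
        using sum_diff_nat_ivl[of 0 m n f] that(2)
        by (subst dist_commute) (simp add: dist_norm lessThan_atLeast0)
      also have "\<dots> \<le> (\<Sum>k=m..<n. norm (f k))"
        by (rule norm_sum)
      also have "\<dots> < \<epsilon>"
        using M[OF that(1), of n] by simp
      finally show ?thesis .
    qed
    have "dist (\<Sum>k<m. f k) (\<Sum>k<n. f k) < \<epsilon>" if "M \<le> m" "M \<le> n" for m n
      using close[of m n] close[of n m] that by (cases "m \<le> n") (auto simp: dist_commute)
    then show "\<exists>M. \<forall>m\<ge>M. \<forall>n\<ge>M. dist (\<Sum>k<m. f k) (\<Sum>k<n. f k) < \<epsilon>"
      by blast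
  qed
  then show ?thesis
    by (simp add: Cauchy_convergent summable_iff_convergent)
qed

text \<open>\<open>coordinates\<close> is the Riesz-Fischer property. It stands in for completeness
  where a vector has to be produced from its coordinates.\<close>

locale hilbert_basis =
  fixes e :: "nat \<Rightarrow> 'a::real_inner"
  assumes orthonormal: "inner (e m) (e n) = (if m = n then 1 else 0)"
    and expansion: "(\<lambda>n. inner (e n) x *\<^sub>R e n) sums x"
    and coordinates: "summable (\<lambda>n. (h n)\<^sup>2) \<Longrightarrow> \<exists>x. \<forall>n. inner (e n) x = h n"
begin

lemma parseval: "(\<lambda>n. inner (e n) x * inner (e n) y) sums inner x y"
proof -
  have "(\<lambda>n. inner (inner (e n) x *\<^sub>R e n) y) sums inner x y"
    by (rule bounded_linear.sums[OF bounded_linear_inner_left expansion])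
  then show ?thesis
    by simp
qed

lemma eq_iff_coordinates: "x = y \<longleftrightarrow> (\<forall>n. inner (e n) x = inner (e n) y)"
proof
  assume eq: "\<forall>n. inner (e n) x = inner (e n) y"
  show "x = y"
    using expansion[of x] expansion[of y] unfolding eq[rule_format] by (rule sums_unique2)
qed simp

text \<open>The terms of the convergent Parseval series are the squares of the coordinates.\<close>

lemma coordinates_tendsto_0: "(\<lambda>n. inner (e n) x) \<longlonglongrightarrow> 0"
proof -
  have "(\<lambda>n. (inner (e n) x)\<^sup>2) \<longlonglongrightarrow> 0"
    using parseval[of x x] by (auto simp: power2_eq_square intro: summable_LIMSEQ_zero sums_summable)
  then show ?thesis
    by (simp add: power_tendsto_0_iff)
qed

lemma norm_basis: "norm (e n) = 1"
  by (simp add: norm_eq_sqrt_inner orthonormal)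

lemma inj_basis: "inj e"
proof (rule injI, rule ccontr)
  fix m n assume "e m = e n" "m \<noteq> n"
  then show False
    using orthonormal[of m n] orthonormal[of n n] by simp
qed

lemma independent_basis: "independent (e ` F)"
proof (rule pairwise_orthogonal_independent)
  show "pairwise orthogonal (e ` F)"
    by (auto simp: pairwise_def orthogonal_def orthonormal)
  have "e n \<noteq> 0" for n
    using norm_basis[of n] by auto
  then show "0 \<notin> e ` F"
    by auto
qed

lemma in_span_basis:
  assumes "finite F" and "\<And>n. n \<notin> F \<Longrightarrow> inner (e n) x = 0"
  shows "x \<in> span (e ` F)"
proof -
  have "(\<lambda>n. inner (e n) x *\<^sub>R e n) sums (\<Sum>n\<in>F. inner (e n) x *\<^sub>R e n)"
    using assms by (intro sums_finite) auto
  then have "x = (\<Sum>n\<in>F. inner (e n) x *\<^sub>R e n)"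
    using expansion by (rule sums_unique2[symmetric])
  also have "\<dots> \<in> span (e ` F)"
    by (intro span_sum span_scale span_base) auto
  finally show ?thesis .
qed

lemma norm_finite_sum: "norm (\<Sum>n<k. h n *\<^sub>R e n) = sqrt (\<Sum>n<k. (h n)\<^sup>2)"
proof -
  have "inner (e m) (\<Sum>n<k. h n *\<^sub>R e n) = h m" if "m < k" for m
  proof -
    have "inner (e m) (\<Sum>n<k. h n *\<^sub>R e n) = (\<Sum>n<k. if m = n then h n else 0)"
      unfolding inner_sum_right by (intro sum.cong) (auto simp: orthonormal)
    then show ?thesis
      using that by simp
  qed
  then show ?thesis
    unfolding norm_eq_sqrt_inner inner_sum_left by (simp add: power2_eq_square)
qed

text \<open>
  \<^const>\<open>adjoint\<close> is a choice that is only known to be meaningful once some adjoint exists; here it is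
  constructed coordinatewise.
\<close>

lemma inner_adjoint:
  fixes T :: "'a \<Rightarrow> 'b::real_inner"
  assumes "bounded_linear T"
  shows "inner (T x) y = inner x (adjoint T y)"
proof -
  interpret T: bounded_linear T by fact
  have "\<exists>z. \<forall>x. inner (T x) y = inner x z" for y
  proof -
    define h where "h n = inner (T (e n)) y" for n
    obtain K where K: "0 \<le> K" "\<And>x. norm (T x) \<le> norm x * K"
      using T.nonneg_bounded by blast
    have "(\<Sum>n<k. (h n)\<^sup>2) \<le> (K * norm y)\<^sup>2" for k
    proof -
      \<comment> \<open>\<open>?s\<close> is the norm of the partial sum weighted by
        \<open>h\<close>. Testing \<open>T\<close> on that sum gives
        \<open>?s * ?s \<le> ?s * (K * norm y)\<close>, and one factor cancels.\<close>
      let ?s = "sqrt (\<Sum>n<k. (h n)\<^sup>2)"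
      have "(\<Sum>n<k. (h n)\<^sup>2) = inner (T (\<Sum>n<k. h n *\<^sub>R e n)) y"
        by (simp add: T.sum T.scaleR inner_sum_left h_def power2_eq_square)
      also have "\<dots> \<le> norm (T (\<Sum>n<k. h n *\<^sub>R e n)) * norm y"
        by (rule norm_cauchy_schwarz)
      also have "\<dots> \<le> ?s * K * norm y"
        using K(2)[of "\<Sum>n<k. h n *\<^sub>R e n"]
        by (intro mult_right_mono) (auto simp: norm_finite_sum)
      finally have "?s * ?s \<le> ?s * (K * norm y)"
        by (simp add: sum_nonneg mult.assoc)
      moreover have "0 \<le> ?s" "0 \<le> K * norm y"
        using K(1) by (simp_all add: sum_nonneg)
      ultimately have "?s \<le> K * norm y"
        by (metis mult_le_cancel_left_pos order_le_less)
      then have "?s\<^sup>2 \<le> (K * norm y)\<^sup>2"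
        by (intro power_mono) (auto simp: sum_nonneg)
      then show ?thesis
        by (simp add: sum_nonneg)
    qed
    then have "summable (\<lambda>n. (h n)\<^sup>2)"
      by (intro summableI_nonneg_bounded) auto
    then obtain z where z: "\<And>n. inner (e n) z = h n"
      using coordinates by blast
    have "inner (T x) y = inner x z" for x
    proof -
      have "(\<lambda>n. inner (T (inner (e n) x *\<^sub>R e n)) y) sums inner (T x) y"
        by (rule bounded_linear.sums[OF bounded_linear_inner_left T.sums[OF expansion]])
      then have "(\<lambda>n. inner (e n) x * inner (e n) z) sums inner (T x) y"
        by (simp add: T.scaleR z h_def)
      then show ?thesis
        using parseval by (rule sums_unique2)
    qed
    then show ?thesis
      by blast
  qed
  then obtain g where g: "\<forall>x y. inner (T x) y = inner x (g y)"
    by metis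
  then show ?thesis
    using adjoint_unique[OF g] by simp
qed

end

text \<open>\<open>diagonal\<close> is the operator identity of a spectral decomposition written in
  coordinates, so that the arguments below need no unitary operator.\<close>

locale diagonalised_compact_operator = hilbert_basis e
  for e :: "nat \<Rightarrow> 'a::real_inner" +
  fixes T :: "'a \<Rightarrow> 'b::{real_inner, complete_space}" and lam :: "nat \<Rightarrow> real"
  assumes compact: "compact_operator T" and inj: "inj T"
    and diagonal: "inner (e n) (adjoint T (T x)) = lam n * inner (e n) x"
begin

lemma bounded_linear: "bounded_linear T"
proof -
  have lin: "linear T" and "bounded (closure (T ` cball 0 1))"
    using compact by (auto simp: compact_operator_def intro!: compact_imp_bounded)
  then obtain K where K: "\<And>x. norm x \<le> 1 \<Longrightarrow> norm (T x) \<le> K"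
    using closure_subset unfolding bounded_iff by (metis image_eqI mem_cball_0 subsetD)
  have "norm (T x) \<le> norm x * K" for x
  proof (cases "x = 0")
    case True
    then show ?thesis
      by (simp add: linear_0[OF lin])
  next
    case False
    then have "norm (T (x /\<^sub>R norm x)) \<le> K"
      by (intro K) simp
    then show ?thesis
      using False by (simp add: linear_scale[OF lin] field_simps)
  qed
  then show ?thesis
    using lin by (auto intro!: bounded_linear_intro[of T K] simp: linear_add linear_scale)
qed

sublocale T: bounded_linear T
  by (rule bounded_linear)

text \<open>Moving \<open>T\<close> across to its adjoint shows that the images of the basis vectors
  are orthogonal with squared norms \<open>lam n\<close>.\<close>

lemma inner_T: "inner (T (e n)) (T x) = lam n * inner (e n) x"
  using inner_adjoint[OF bounded_linear, of "e n" "T x"] diagonal by simp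

lemma norm_T_basis: "(norm (T (e n)))\<^sup>2 = lam n"
  using inner_T[of n "e n"] by (simp add: power2_norm_eq_inner orthonormal)

lemma lam_pos: "0 < lam n"
proof -
  have "e n \<noteq> 0"
    using norm_basis[of n] by auto
  then have "T (e n) \<noteq> 0"
    using inj T.zero by (metis injD)
  then show ?thesis
    using norm_T_basis[of n] by (metis zero_less_norm_iff zero_less_power)
qed

lemma dist_T_basis:
  assumes "m \<noteq> n"
  shows "(dist (T (e m)) (T (e n)))\<^sup>2 = lam m + lam n"
  using assms
  by (simp add: dist_norm power2_norm_eq_inner inner_diff_left inner_diff_right inner_T orthonormal)

text \<open>Otherwise infinitely many images \<open>T (e n)\<close> of unit vectors would lie at
  mutual distance above \<open>sqrt \<epsilon>\<close>, and no subsequence of them could converge,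
  against compactness.\<close>

lemma finite_superlevel:
  assumes "0 < \<epsilon>"
  shows "finite {n. \<epsilon> < lam n}"
proof (rule ccontr)
  assume "infinite {n. \<epsilon> < lam n}"
  then obtain q :: "nat \<Rightarrow> nat" where q: "strict_mono q" "\<And>k. \<epsilon> < lam (q k)"
    using infinite_enumerate by (metis mem_Collect_eq)
  have "compact (closure (T ` cball 0 1))"
    using compact by (simp add: compact_operator_def)
  moreover have "\<forall>k. T (e (q k)) \<in> closure (T ` cball 0 1)"
    using closure_subset by (auto simp: norm_basis intro!: subsetD[OF closure_subset])
  ultimately obtain l r where r: "strict_mono r" and l: "((\<lambda>k. T (e (q k))) \<circ> r) \<longlonglongrightarrow> l"
    unfolding compact_def by meson
  then have "Cauchy ((\<lambda>k. T (e (q k))) \<circ> r)"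
    by (blast intro: LIMSEQ_imp_Cauchy)
  then obtain M where M: "\<And>m n. m \<ge> M \<Longrightarrow> n \<ge> M \<Longrightarrow>
      dist (T (e (q (r m)))) (T (e (q (r n)))) < sqrt \<epsilon>"
    using assms metric_CauchyD[of _ "sqrt \<epsilon>"] by fastforce
  have "q (r M) \<noteq> q (r (Suc M))"
    using q(1) r by (metis lessI nat_neq_iff strict_monoD)
  then have "lam (q (r M)) + lam (q (r (Suc M))) < \<epsilon>"
    using power_strict_mono[OF M[of M "Suc M"], of 2] assms by (simp add: dist_T_basis)
  with q(2)[of "r M"] lam_pos[of "q (r (Suc M))"] show False
    by linarith
qed

text \<open>In coordinates the eigenvalue equation forces every coordinate with
  \<open>lam n \<noteq> c\<close> to vanish. As c is positive, only finitely many indices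
  remain.\<close>

lemma dim_eigenspace:
  assumes "0 < c"
  shows "dim {x. adjoint T (T x) = c *\<^sub>R x} = card {n. lam n = c}"
proof -
  let ?F = "{n. lam n = c}"
  have eigen: "adjoint T (T x) = c *\<^sub>R x \<longleftrightarrow> (\<forall>n. n \<notin> ?F \<longrightarrow> inner (e n) x = 0)" for x
    by (subst eq_iff_coordinates) (auto simp: diagonal)
  have fin: "finite ?F"
    using finite_superlevel[of "c / 2"] by (rule rev_finite_subset) (use assms in auto)
  show ?thesis
  proof (rule dim_unique)
    show "e ` ?F \<subseteq> {x. adjoint T (T x) = c *\<^sub>R x}"
      unfolding eigen by (auto simp: orthonormal)
    show "{x. adjoint T (T x) = c *\<^sub>R x} \<subseteq> span (e ` ?F)"
      unfolding eigen using in_span_basis[OF fin] by auto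
    show "independent (e ` ?F)"
      by (rule independent_basis)
    show "card (e ` ?F) = card ?F"
      by (intro card_image inj_on_subset[OF inj_basis]) simp
  qed
qed

lemma lam_tendsto_0: "lam \<longlonglongrightarrow> 0"
proof (rule order_tendstoI)
  fix a :: real assume "a < 0"
  then show "eventually (\<lambda>n. a < lam n) sequentially"
    using lam_pos by (intro always_eventually allI) (meson less_trans)
next
  fix a :: real assume "0 < a"
  then have "finite {n. \<not> lam n < a}"
    using finite_superlevel[of "a / 2"] by (auto elim: rev_finite_subset)
  then show "eventually (\<lambda>n. lam n < a) sequentially"
    unfolding cofinite_eq_sequentially[symmetric] eventually_cofinite .
qed

text \<open>
  The witness is \<open>y = (\<Sum>k. T (e (q k)))\<close> for a rapidly decaying subsequence: a preimage of \<open>y\<close>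
  would have the coordinate 1 at every \<open>q k\<close>.
\<close>

lemma range_not_closed: "\<not> closed (range T)"
proof
  assume closed: "closed (range T)"
  \<comment> \<open>The square turns into the bound \<open>(1/2)^k\<close> for the norm of
    \<open>T (e (q k))\<close>; strict growth of q keeps the basis vectors distinct.\<close>
  have "\<exists>q. \<forall>k. lam (q k) < ((1/2)^k)\<^sup>2 \<and> q k < q (Suc k)"
  proof (rule dependent_nat_choice)
    have "\<exists>n>m. lam n < b" if "0 < b" for b m
    proof -
      have "eventually (\<lambda>n. lam n < b \<and> m < n) sequentially"
        using order_tendstoD(2)[OF lam_tendsto_0 that] eventually_gt_at_top[of m]
        by eventually_elim simp
      then show ?thesis
        by (auto dest: eventually_happens)
    qed
    note ex = this
    show "\<exists>n. lam n < ((1/2)^0)\<^sup>2"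
      using ex[of "((1/2)^0)\<^sup>2" 0] by auto
    show "\<exists>m. lam m < ((1/2)^Suc k)\<^sup>2 \<and> n < m" for n k
      using ex[of "((1/2)^Suc k)\<^sup>2" n] by auto
  qed
  then obtain q where q: "\<And>k. lam (q k) < ((1/2)^k)\<^sup>2" and q_mono: "strict_mono q"
    unfolding strict_mono_Suc_iff by blast
  have "norm (T (e (q k))) \<le> (1/2)^k" for k
    by (rule power2_le_imp_le) (use q[of k] in \<open>simp_all add: norm_T_basis\<close>)
  then have "summable (\<lambda>k. T (e (q k)))"
    by (intro summable_norm_cancel_complete[OF
        summable_comparison_test'[OF summable_geometric[of "1/2 :: real"], of 0]]) simp_all
  then obtain y where y: "(\<lambda>k. T (e (q k))) sums y"
    by (auto simp: summable_def)
  have "\<forall>n. (\<Sum>k<n. T (e (q k))) \<in> range T"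
    unfolding T.sum[symmetric] by blast
  then have "y \<in> range T"
    using closed_sequentially[OF closed, of "\<lambda>n. \<Sum>k<n. T (e (q k))"] y
    unfolding sums_def by blast
  then obtain x where x: "y = T x"
    by blast
  have "inner (e (q j)) x = 1" for j
  proof -
    have "(\<lambda>k. inner (T (e (q j))) (T (e (q k)))) sums inner (T (e (q j))) y"
      by (rule bounded_linear.sums[OF bounded_linear_inner_right y])
    moreover have "inner (T (e (q j))) (T (e (q k))) = (if k = j then lam (q j) else 0)" for k
      using strict_mono_eq[OF q_mono, of j k] by (auto simp: inner_T orthonormal)
    ultimately have "(\<lambda>k. if k = j then lam (q j) else 0) sums (lam (q j) * inner (e (q j)) x)"
      by (simp add: x inner_T)
    then have "lam (q j) * inner (e (q j)) x = lam (q j)"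
      using sums_single[of j "\<lambda>_. lam (q j)"] by (rule sums_unique2)
    then show ?thesis
      using lam_pos[of "q j"] by simp
  qed
  \<comment> \<open>Coordinates of a fixed vector tend to 0 along every subsequence, which excludes
    the constant value 1.\<close>
  moreover have "(\<lambda>j. inner (e (q j)) x) \<longlonglongrightarrow> 0"
    using LIMSEQ_subseq_LIMSEQ[OF coordinates_tendsto_0 q_mono, of x] by (simp add: o_def)
  ultimately have "(\<lambda>j::nat. 1::real) \<longlonglongrightarrow> 0"
    by simp
  then show False
    by (simp add: LIMSEQ_const_iff)
qed

end

section \<open>Square-summable sequences and their unitary images\<close>

lemma L2_count_space_nat: "f \<in> L2 (count_space (UNIV :: nat set)) \<longleftrightarrow> summable (\<lambda>n. (f n)\<^sup>2)"
  by (simp add: L2_def integrable_count_space_nat_iff)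

lemma integral_count_space_indicator:
  fixes f :: "nat \<Rightarrow> real"
  shows "(\<integral>\<omega>. indicator {n} \<omega> * f \<omega> \<partial>count_space UNIV) = f n"
proof -
  have "{a. indicator {n} a * f a \<noteq> 0} = (if f n = 0 then {} else {n})"
    by (auto simp: indicator_def)
  then show "(\<integral>\<omega>. indicator {n} \<omega> * f \<omega> \<partial>count_space UNIV) = f n"
    by (subst lebesgue_integral_count_space_finite_support) auto
qed

context
  fixes W :: "(nat \<Rightarrow> real) \<Rightarrow> 'a::real_inner"
  assumes W: "unitary_on_L2 (count_space (UNIV :: nat set)) W"
begin

lemma W_add: "f \<in> L2 (count_space UNIV) \<Longrightarrow> g \<in> L2 (count_space UNIV) \<Longrightarrow>
    W (\<lambda>n. f n + g n) = W f + W g"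
  and W_scale: "f \<in> L2 (count_space UNIV) \<Longrightarrow> W (\<lambda>n. c * f n) = c *\<^sub>R W f"
  and W_inner: "f \<in> L2 (count_space UNIV) \<Longrightarrow> g \<in> L2 (count_space UNIV) \<Longrightarrow>
    inner (W f) (W g) = (\<integral>n. f n * g n \<partial>count_space UNIV)"
  and W_surj: "W ` L2 (count_space UNIV) = UNIV"
  using W unfolding unitary_on_L2_def by blast+

lemma indicator_in_L2: "indicator {n} \<in> L2 (count_space (UNIV :: nat set))"
  unfolding L2_count_space_nat by (rule summable_finite[of "{n}"]) auto

lemma coordinate_W: "f \<in> L2 (count_space UNIV) \<Longrightarrow> inner (W (indicator {n})) (W f) = f n"
  by (simp add: W_inner indicator_in_L2 integral_count_space_indicator)

text \<open>By surjectivity x is \<open>W f\<close>, and its coordinates are the values of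
  \<open>f\<close>. The remainder of the expansion is the image of a tail of \<open>f\<close>, whose
  norm tends to 0 because \<open>W\<close> is isometric.\<close>

lemma hilbert_basis_W: "hilbert_basis (\<lambda>n. W (indicator {n}))"
proof
  show "inner (W (indicator {m})) (W (indicator {n})) = (if m = n then 1 else 0)" for m n
    by (simp add: coordinate_W indicator_in_L2)
next
  fix h :: "nat \<Rightarrow> real" assume "summable (\<lambda>n. (h n)\<^sup>2)"
  then show "\<exists>x. \<forall>n. inner (W (indicator {n})) x = h n"
    using coordinate_W[of h] by (auto simp: L2_count_space_nat)
next
  fix x
  obtain f where f: "f \<in> L2 (count_space UNIV)" and x: "x = W f"
    using W_surj by blast
  then have f2: "summable (\<lambda>n. (f n)\<^sup>2)"
    by (simp add: L2_count_space_nat)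
  have tail: "(\<lambda>n. if n < k then 0 else f n) \<in> L2 (count_space UNIV)" for k
    unfolding L2_count_space_nat
    by (rule summable_comparison_test'[OF f2, of 0]) auto
  \<comment> \<open>Additivity of \<open>W\<close> covers finite sums only, so each induction step
    splits one coordinate off the tail.\<close>
  have head: "W f = (\<Sum>n<k. f n *\<^sub>R W (indicator {n})) + W (\<lambda>n. if n < k then 0 else f n)" for k
  proof (induction k)
    case (Suc k)
    have "W (\<lambda>n. if n < k then 0 else f n)
        = W (\<lambda>n. f k * indicator {k} n + (if n < Suc k then 0 else f n))"
      by (rule arg_cong[where f = W]) (auto simp: indicator_def less_Suc_eq)
    also have "\<dots> = W (\<lambda>n. f k * indicator {k} n) + W (\<lambda>n. if n < Suc k then 0 else f n)"
      using indicator_in_L2[of k]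
      by (intro W_add tail)
         (auto simp: L2_count_space_nat power_mult_distrib intro: summable_mult)
    also have "W (\<lambda>n. f k * indicator {k} n) = f k *\<^sub>R W (indicator {k})"
      by (rule W_scale) (rule indicator_in_L2)
    finally show ?case
      using Suc by (simp add: add.assoc)
  qed simp
  have "(\<lambda>k. (norm (W (\<lambda>n. if n < k then 0 else f n)))\<^sup>2) \<longlonglongrightarrow> 0"
  proof -
    have "(norm (W (\<lambda>n. if n < k then 0 else f n)))\<^sup>2 = (\<Sum>n. (f (n + k))\<^sup>2)" for k
    proof -
      have "(norm (W (\<lambda>n. if n < k then 0 else f n)))\<^sup>2
          = (\<integral>n. (if n < k then 0 else f n)\<^sup>2 \<partial>count_space UNIV)"
        unfolding power2_norm_eq_inner W_inner[OF tail tail] by (simp only: power2_eq_square)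
      also have "\<dots> = (\<Sum>n. (if n < k then 0 else f n)\<^sup>2)"
        using tail by (intro integral_count_space_nat) (simp add: L2_def)
      also have "\<dots> = (\<Sum>n. (f (n + k))\<^sup>2)"
        using suminf_split_initial_segment[OF tail[unfolded L2_count_space_nat], of k k]
        by simp
      finally show ?thesis .
    qed
    then show ?thesis
      using suminf_exist_split2[OF f2] by simp
  qed
  then have "(\<lambda>k. W (\<lambda>n. if n < k then 0 else f n)) \<longlonglongrightarrow> 0"
    by (simp add: tendsto_norm_zero_iff)
  then have "(\<lambda>k. x - W (\<lambda>n. if n < k then 0 else f n)) \<longlonglongrightarrow> x - 0"
    by (intro tendsto_diff tendsto_const)
  moreover have "x - W (\<lambda>n. if n < k then 0 else f n)
      = (\<Sum>n<k. inner (W (indicator {n})) x *\<^sub>R W (indicator {n}))" for k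
    unfolding x coordinate_W[OF f] using head[of k] by (simp add: algebra_simps)
  ultimately show "(\<lambda>n. inner (W (indicator {n})) x *\<^sub>R W (indicator {n})) sums x"
    by (simp add: sums_def)
qed

text \<open>The choice in \<open>L2_adjoint\<close> is pinned down at every point by integrating
  against \<open>indicator {n}\<close>, as points have mass 1.\<close>

lemma L2_adjoint_count_space: "L2_adjoint (count_space UNIV) W x n = inner (W (indicator {n})) x"
proof -
  obtain g where g: "g \<in> L2 (count_space UNIV)" "x = W g"
    using W_surj by blast
  then have "\<exists>h. h \<in> L2 (count_space UNIV) \<and>
      (\<forall>f\<in>L2 (count_space UNIV). inner (W f) x = (\<integral>\<omega>. f \<omega> * h \<omega> \<partial>count_space UNIV))"
    using W_inner by blast
  then have "inner (W (indicator {n})) x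
      = (\<integral>\<omega>. indicator {n} \<omega> * L2_adjoint (count_space UNIV) W x \<omega> \<partial>count_space UNIV)"
    unfolding L2_adjoint_def by (rule someI2_ex) (use indicator_in_L2 in blast)
  then show ?thesis
    by (simp add: integral_count_space_indicator)
qed

end

section \<open>Equality of the two counting functions and of the intervals\<close>

theorem theorem2:
  fixes T :: "'x::{real_inner, complete_space} \<Rightarrow> 'y::{real_inner, complete_space}"
    and \<sigma> :: "nat \<Rightarrow> real"
    and W :: "(nat \<Rightarrow> real) \<Rightarrow> 'x"
    and lam :: "nat \<Rightarrow> real"
  assumes "infinite_dimensional TYPE('x)" and "infinite_dimensional TYPE('y)"
    and "separable_space (euclidean :: 'x topology)"
    and "separable_space (euclidean :: 'y topology)"
    and "compact_operator T" and "inj T"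
    and "is_singular_values T \<sigma>"
    and "spectral_decomposition T (count_space (UNIV :: nat set)) W lam"
  shows "definition_II_applicable T (count_space (UNIV :: nat set)) W lam \<and>
         A_sv \<sigma> = A_Phi lam (count_space (UNIV :: nat set)) \<and>
         B_sv \<sigma> = B_Phi lam (count_space (UNIV :: nat set)) \<and>
         (\<forall>s>0. ill_posed_of_degree_I T \<sigma> s \<longleftrightarrow>
                ill_posed_of_degree_II T (count_space (UNIV :: nat set)) W lam s)"
proof -
  let ?M = "count_space (UNIV :: nat set)"
  have W: "unitary_on_L2 ?M W"
    using assms(8) by (simp add: spectral_decomposition_def)
  interpret diagonalised_compact_operator "\<lambda>n. W (indicator {n})" T lam
  proof (intro diagonalised_compact_operator.intro diagonalised_compact_operator_axioms.intro)
    show "hilbert_basis (\<lambda>n. W (indicator {n}))"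
      using W by (rule hilbert_basis_W)
    show "inner (W (indicator {n})) (adjoint T (T x)) = lam n * inner (W (indicator {n})) x" for n x
    proof -
      obtain f where f: "f \<in> L2 ?M" "x = W f"
        using W_surj[OF W] by blast
      \<comment> \<open>Nonempty sets have positive counting measure, so an identity almost
        everywhere holds at every n.\<close>
      then have "L2_adjoint ?M W (adjoint T (T x)) n = lam n * f n"
        using assms(8) by (simp add: spectral_decomposition_def AE_count_space)
      then show ?thesis
        using f by (simp add: L2_adjoint_count_space[OF W] coordinate_W[OF W])
    qed
  qed (fact assms)+

  define N where "N \<epsilon> = card {n. 1 \<le> n \<and> \<epsilon> < (\<sigma> n)\<^sup>2}" for \<epsilon>
  have \<sigma>_pos: "0 < \<sigma> n" if "1 \<le> n" for n
    using assms(7) that by (simp add: is_singular_values_def)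
  have \<sigma>_dec: "(\<sigma> n)\<^sup>2 \<le> (\<sigma> m)\<^sup>2" if "1 \<le> m" "m \<le> n" for m n
  proof (rule power_mono)
    show "\<sigma> n \<le> \<sigma> m"
      using assms(7) that by (simp add: is_singular_values_def)
    show "0 \<le> \<sigma> n"
      using \<sigma>_pos[of n] that by simp
  qed
  \<comment> \<open>The multiplicity of a singular value is the dimension of its eigenspace, which
    \<open>dim_eigenspace\<close> turns into a number of indices of \<open>lam\<close>.\<close>
  have fibre: "finite {n \<in> {1..}. (\<sigma> n)\<^sup>2 = c}
      \<and> card {n \<in> {1..}. (\<sigma> n)\<^sup>2 = c} = card {n \<in> UNIV. lam n = c}" if "0 < c" for c
  proof -
    have "(\<sigma> n)\<^sup>2 = c \<longleftrightarrow> \<sigma> n = sqrt c" if "1 \<le> n" for n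
      using \<sigma>_pos[OF that] \<open>0 < c\<close> by auto
    then have eq: "{n \<in> {1..}. (\<sigma> n)\<^sup>2 = c} = {n. 1 \<le> n \<and> \<sigma> n = sqrt c}"
      by auto
    have "0 < sqrt c"
      using that by simp
    then have "finite {n. 1 \<le> n \<and> \<sigma> n = sqrt c} \<and>
        card {n. 1 \<le> n \<and> \<sigma> n = sqrt c} = dim {x. adjoint T (T x) = (sqrt c)\<^sup>2 *\<^sub>R x}"
      using assms(7) unfolding is_singular_values_def by blast
    then show ?thesis
      using that unfolding eq by (simp add: dim_eigenspace)
  qed
  \<comment> \<open>Only cardinalities are compared, so it does no harm that \<open>lam\<close> is
    indexed from 0 and \<sigma> from 1.\<close>
  have superlevel: "finite {n. 1 \<le> n \<and> \<epsilon> < (\<sigma> n)\<^sup>2}" "N \<epsilon> = card {n. \<epsilon> < lam n}"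
    if "0 < \<epsilon>" for \<epsilon>
    using card_superlevel_eq[of UNIV \<epsilon> lam "{1..}" "\<lambda>n. (\<sigma> n)\<^sup>2"] finite_superlevel[OF that]
      fibre that
    by (simp_all add: N_def)
  have le_N_iff: "n \<le> N \<epsilon> \<longleftrightarrow> \<epsilon> < (\<sigma> n)\<^sup>2" if "0 < \<epsilon>" "1 \<le> n" for \<epsilon> n
    unfolding N_def using \<sigma>_dec superlevel(1)[OF that(1)] that(2)
    by (rule le_card_superlevel_iff)
  have Phi_eq: "Phi lam ?M \<epsilon> = ennreal (real (N \<epsilon>))" if "0 < \<epsilon>" for \<epsilon>
    using finite_superlevel[OF that] superlevel(2)[OF that]
    by (simp add: Phi_def emeasure_count_space ennreal_of_nat_eq_real_of_nat)
  have Phi_ev: "eventually (\<lambda>\<epsilon>. Phi lam ?M \<epsilon> = ennreal (real (N \<epsilon>))) (at_right 0)"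
    using eventually_at_right_less by eventually_elim (rule Phi_eq)

  have "condition_b lam ?M"
    unfolding condition_b_def
  proof (intro conjI allI impI)
    show "Phi lam ?M \<epsilon> < \<infinity>" if "0 < \<epsilon>" for \<epsilon>
      by (simp add: Phi_eq[OF that])
    have "((\<lambda>\<epsilon>. of_nat (N \<epsilon>) :: ennreal) \<longlongrightarrow> \<infinity>) (at_right 0)"
      using filterlim_compose[OF of_nat_tendsto_top_ennreal
          counting_function_at_top[OF \<sigma>_pos le_N_iff]]
      by simp
    then show "(Phi lam ?M \<longlongrightarrow> \<infinity>) (at_right 0)"
      using Phi_ev
      by (subst tendsto_cong[where g = "\<lambda>\<epsilon>. of_nat (N \<epsilon>)"])
        (auto simp: ennreal_of_nat_eq_real_of_nat)
  qed
  then have applicable: "definition_II_applicable T ?M W lam"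
    using assms range_not_closed bounded_linear
    by (simp add: definition_II_applicable_def condition_a_def)
  \<comment> \<open>Near 0 the value of \<open>Phi\<close> is a finite natural number, which
    \<open>enn2real\<close> recovers exactly.\<close>
  have quotient: "eventually (\<lambda>\<epsilon>. ereal (ln \<epsilon> / (- 2 * ln (real (N \<epsilon>))))
      = ereal (ln \<epsilon> / (- 2 * ln (enn2real (Phi lam ?M \<epsilon>))))) (at_right 0)"
    using Phi_ev by eventually_elim simp
  have A: "A_sv \<sigma> = A_Phi lam ?M"
    unfolding A_sv_def A_Phi_def
    by (rule trans[OF liminf_eq_Liminf_counting_function[of \<sigma> N] Liminf_eq[OF quotient]])
      (use \<sigma>_pos le_N_iff in blast)+
  have B: "B_sv \<sigma> = B_Phi lam ?M"
    unfolding B_sv_def B_Phi_def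
    by (rule trans[OF limsup_eq_Limsup_counting_function[of \<sigma> N] Limsup_eq[OF quotient]])
      (use \<sigma>_pos le_N_iff in blast)+
  show ?thesis
    using applicable A B assms
    by (simp add: ill_posed_of_degree_I_def ill_posed_of_degree_II_def)
qed

end
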